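(* Suppose the triple $(P,Q,R)$ of functions of $x$ satisfies Ramanujan's differential equations \begin{align*} \frac{dP}{dx}&=\frac{1}{6}(P^2-Q),\\ \frac{dQ}{dx}&=\frac{2}{3}(PQ-R),\\ \frac{dR}{dx}&=PR-Q^2. \end{align*} Let $\nu$ be a solution to the quartic equation $$\nu^4-\frac{2}{3}Q\nu^2+\frac{8}{27}R\nu-\frac{1}{27}Q^2=0.$$ Then the triple $$(p,q,r)=\left(P-2\nu,\;-Q+10\nu^2,\;-R-35\nu^3+7Q\nu\right)$$ also satisfies Ramanujan's differential equations, i.e. $p'=\frac16(p^2-q)$, $q'=\frac23(pq-r)$, $r'=pr-q^2$.
   Context: $P,Q,R$ are functions of the variable $x$, and $'$ denotes $d/dx$. The quantity $\nu$, a root of a polynomial equation with coefficients depending on $x$, is a differentiable function of $x$ satisfying that equation identically in $x$. *)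

theory Defs
  imports "HOL-Analysis.Analysis"
begin

text \<open>
  The variable \<open>x\<close> ranges over a set \<open>S\<close> in a real normed field (the reals or the complex numbers),
  and \<open>d/dx\<close> is the derivative within \<open>S\<close>. This treats several readings of ``functions of \<open>x\<close>''
  at once: for open \<open>S\<close> it is the ordinary real or complex derivative, and for an interval of the
  real line embedded in the complex plane it is the derivative of a complex-valued function of a
  real variable.
\<close>

definition ramanujan_on ::
  "'a::real_normed_field set \<Rightarrow> ('a \<Rightarrow> 'a) \<Rightarrow> ('a \<Rightarrow> 'a) \<Rightarrow> ('a \<Rightarrow> 'a) \<Rightarrow> bool" where
  "ramanujan_on S P Q R \<longleftrightarrow>
     (\<forall>x\<in>S.
        (P has_field_derivative 1/6 * ((P x)^2 - Q x)) (at x within S) \<and>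
        (Q has_field_derivative 2/3 * (P x * Q x - R x)) (at x within S) \<and>
        (R has_field_derivative P x * R x - (Q x)^2) (at x within S))"

text \<open>
  The domains considered are the locally convex sets. Both open sets and convex sets (hence
  intervals of any kind, also those embedded in the complex plane) are of this form.
\<close>

lemma open_imp_locally_convex:
  fixes S :: "'a::real_normed_vector set"
  assumes "open S"
  shows "locally convex S"
proof (rule locallyI)
  fix w x assume w: "openin (top_of_set S) w" and x: "x \<in> w"
  have "open w" using w assms by (simp add: openin_open_eq)
  then obtain e where e: "e > 0" "ball x e \<subseteq> w"
    using x open_contains_ball by blast
  have "w \<subseteq> S" using w openin_imp_subset by blast
  then have "openin (top_of_set S) (ball x e)"
    using e assms by (simp add: openin_open_eq)
  then show "\<exists>u v. openin (top_of_set S) u \<and> convex v \<and> x \<in> u \<and> u \<subseteq> v \<and> v \<subseteq> w"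
    using e by (intro exI[of _ "ball x e"]) auto
qed

lemma convex_imp_locally_convex:
  fixes S :: "'a::real_normed_vector set"
  assumes "convex S"
  shows "locally convex S"
proof (rule locallyI)
  fix w x assume w: "openin (top_of_set S) w" and x: "x \<in> w"
  obtain T where T: "open T" "w = S \<inter> T" using w by (auto simp: openin_open)
  obtain e where e: "e > 0" "ball x e \<subseteq> T"
    using x T open_contains_ball by blast
  have "openin (top_of_set S) (S \<inter> ball x e)" by (simp add: openin_open_Int)
  moreover have "convex (S \<inter> ball x e)" using assms by (simp add: convex_Int)
  ultimately show "\<exists>u v. openin (top_of_set S) u \<and> convex v \<and> x \<in> u \<and> u \<subseteq> v \<and> v \<subseteq> w"
    using e x T by (intro exI[of _ "S \<inter> ball x e"]) auto
qed

end

theory Submission imports Defs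
begin

text \<open>
  All three equations for \<open>(p, q, r)\<close> are polynomial consequences of the quartic equation and of the
  single formula \<open>\<nu>' = P \<nu> / 3 + \<nu>\<^sup>2 / 2 - Q / 6\<close>, which itself just restates the equation for \<open>p\<close>.
  Write \<open>F (\<nu>, Q, R)\<close> for the quartic. Differentiating \<open>F = 0\<close> along \<open>S\<close> gives
  \<open>F\<^sub>\<nu> (\<nu>' - (P \<nu> / 3 + \<nu>\<^sup>2 / 2 - Q / 6)) = 0\<close>, where \<open>F\<^sub>\<nu>\<close> is the partial derivative in \<open>\<nu>\<close>. So the
  formula holds at each point where \<open>\<nu>\<close> is a simple root.

  At a multiple root one has \<open>Q = 9 \<nu>\<^sup>2\<close> and \<open>R = 27 \<nu>\<^sup>3\<close>, so the discriminant \<open>Q\<^sup>3 - R\<^sup>2\<close> vanishes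
  there. It satisfies the linear equation \<open>\<Delta>' = 2 P \<Delta>\<close>, hence it vanishes in a whole neighbourhood
  of the point. There the quartic factors as \<open>(\<nu> - a/3)\<^sup>3 (\<nu> + a)\<close> with \<open>a = R / Q\<close>, provided that
  \<open>Q \<noteq> 0\<close>; continuity keeps \<open>\<nu>\<close> on the branch \<open>\<nu> = a/3\<close>, whose derivative is read off from those
  of \<open>Q\<close> and \<open>R\<close>. If \<open>Q = 0\<close> at the point, then \<open>R = 0\<close> as well, uniqueness for the system makes \<open>Q\<close>
  and \<open>R\<close> vanish nearby, and then \<open>\<nu>\<^sup>4 = 0\<close> nearby.

  Both propagation steps rest on \<open>vanishing_propagates\<close>, which needs the mean value inequality and
  thus the local convexity of the domain.
\<close>

section \<open>Local propagation of zeros\<close>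

lemma eventually_close_within:
  fixes f :: "'a::metric_space \<Rightarrow> 'b::metric_space"
  assumes "continuous_on S f" "x \<in> S" "e > 0"
  shows "\<forall>\<^sub>F y in nhds x. y \<in> S \<longrightarrow> dist (f y) (f x) < e"
proof -
  obtain r where "r > 0" "\<forall>y\<in>S. dist y x < r \<longrightarrow> dist (f y) (f x) < e"
    using assms unfolding continuous_on_iff by blast
  then show ?thesis unfolding eventually_nhds_metric by blast
qed

text \<open>
  A Gronwall argument by repeated halving: on a convex set of radius at most \<open>1 / (4 C)\<close> around \<open>x\<close>,
  a common bound \<open>K\<close> for \<open>f\<close> and \<open>g\<close> bounds their derivatives by \<open>2 C K\<close>, and the mean value
  inequality then improves \<open>K\<close> to \<open>K / 2\<close>.
\<close>

lemma vanishing_propagates: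
  fixes f g f' g' :: "'a::real_normed_field \<Rightarrow> 'a"
  assumes S: "locally convex S" and x: "x \<in> S" and C: "C > 0"
    and df: "\<And>y. y \<in> S \<Longrightarrow> (f has_field_derivative f' y) (at y within S)"
    and dg: "\<And>y. y \<in> S \<Longrightarrow> (g has_field_derivative g' y) (at y within S)"
    and bound: "\<forall>\<^sub>F y in nhds x. y \<in> S \<longrightarrow>
      norm (f' y) \<le> C * (norm (f y) + norm (g y)) \<and> norm (g' y) \<le> C * (norm (f y) + norm (g y))"
    and zero: "f x = 0" "g x = 0"
  shows "\<forall>\<^sub>F y in nhds x. y \<in> S \<longrightarrow> f y = 0 \<and> g y = 0"
proof -
  have cont: "continuous_on S f" "continuous_on S g"
    using df dg by (auto intro: DERIV_continuous_on)
  have "\<forall>\<^sub>F y in nhds x. y \<in> S \<longrightarrow> norm (f y) < 1 \<and> norm (g y) < 1 \<and>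
      norm (f' y) \<le> C * (norm (f y) + norm (g y)) \<and> norm (g' y) \<le> C * (norm (f y) + norm (g y))"
    using bound eventually_close_within[OF cont(1) x zero_less_one]
      eventually_close_within[OF cont(2) x zero_less_one]
    by eventually_elim (simp add: zero)
  then obtain r where r: "r > 0"
    "\<And>y. dist y x < r \<Longrightarrow> y \<in> S \<Longrightarrow> norm (f y) < 1 \<and> norm (g y) < 1 \<and>
      norm (f' y) \<le> C * (norm (f y) + norm (g y)) \<and> norm (g' y) \<le> C * (norm (f y) + norm (g y))"
    unfolding eventually_nhds_metric by blast
  define e where "e = min r (1 / (4 * C))"
  have e: "e > 0" "e \<le> r" "e \<le> 1 / (4 * C)"
    using r(1) C by (auto simp: e_def)
  have "openin (top_of_set S) (S \<inter> ball x e)" "x \<in> S \<inter> ball x e"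
    using x e by (auto simp: openin_open_Int)
  then obtain u v where uv: "openin (top_of_set S) u" "convex v" "x \<in> u" "u \<subseteq> v"
    "v \<subseteq> S \<inter> ball x e"
    using S unfolding locally_def by meson
  have near: "norm (y - x) \<le> 1 / (4 * C)" "y \<in> S" "dist y x < r" if "y \<in> v" for y
    using uv(5) that e by (auto simp: dist_norm norm_minus_commute subset_iff)
  have dv: "(f has_field_derivative f' y) (at y within v)"
    "(g has_field_derivative g' y) (at y within v)" if "y \<in> v" for y
    using df dg uv(5) that by (auto intro: DERIV_subset)
  have small: "norm (f y) \<le> 1 / 2 ^ n \<and> norm (g y) \<le> 1 / 2 ^ n" if "y \<in> v" for n y
    using that
  proof (induction n arbitrary: y)
    case 0
    then show ?case using r(2)[of y] near[of y] by auto
  next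
    case (Suc n)
    have "C * (norm (f z) + norm (g z)) \<le> C * (2 / 2 ^ n)" if "z \<in> v" for z
      using Suc.IH[OF that] C by (intro mult_left_mono) auto
    then have d: "norm (f' z) \<le> C * (2 / 2 ^ n)" "norm (g' z) \<le> C * (2 / 2 ^ n)"
      if "z \<in> v" for z
      using r(2)[of z] near[of z] that by (meson order_trans)+
    have xv: "x \<in> v" using uv by auto
    have *: "C * (2 / 2 ^ n) * norm (y - x) \<le> 1 / 2 ^ Suc n"
    proof -
      have "C * (2 / 2 ^ n) * norm (y - x) \<le> C * (2 / 2 ^ n) * (1 / (4 * C))"
        using near[OF Suc.prems] C by (intro mult_left_mono) auto
      also have "\<dots> = 1 / 2 ^ Suc n" using C by (simp add: field_simps)
      finally show ?thesis .
    qed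
    have "norm (f y - f x) \<le> C * (2 / 2 ^ n) * norm (y - x)"
      by (rule field_differentiable_bound[OF uv(2) dv(1) d(1) Suc.prems xv])
    moreover have "norm (g y - g x) \<le> C * (2 / 2 ^ n) * norm (y - x)"
      by (rule field_differentiable_bound[OF uv(2) dv(2) d(2) Suc.prems xv])
    ultimately show ?case using * zero by simp
  qed
  have "(\<lambda>n. 1 / 2 ^ n :: real) \<longlonglongrightarrow> 0"
    using LIMSEQ_power_zero[of "1/2::real"] by (simp add: power_one_over)
  then have vanish: "f y = 0 \<and> g y = 0" if "y \<in> v" for y
    using small[OF that] by (metis LIMSEQ_le_const norm_le_zero_iff)
  obtain T where "open T" "u = S \<inter> T"
    using uv(1) by (auto simp: openin_open)
  then have "\<forall>\<^sub>F y in nhds x. y \<in> T"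
    using uv(3) by (auto intro: eventually_nhds_in_open)
  then show ?thesis
    by eventually_elim (use \<open>u = S \<inter> T\<close> uv(4) vanish in auto)
qed

lemma derivative_zero_of_eventually_zero:
  fixes f :: "'a::real_normed_field \<Rightarrow> 'a"
  assumes D: "(f has_field_derivative D) (at x within S)"
    and zero: "\<forall>\<^sub>F y in nhds x. y \<in> S \<longrightarrow> f y = 0"
    and x: "x \<in> S" and nontrivial: "at x within S \<noteq> bot"
  shows "D = 0"
proof -
  have "f x = 0"
    using eventually_nhds_x_imp_x[OF zero] x by blast
  have "\<forall>\<^sub>F y in at x within S. (f y - f x) / (y - x) = 0"
    unfolding eventually_at_filter using zero by eventually_elim (simp add: \<open>f x = 0\<close>)
  then have "((\<lambda>y. (f y - f x) / (y - x)) \<longlongrightarrow> 0) (at x within S)"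
    by (rule tendsto_eventually)
  then show ?thesis
    using D nontrivial unfolding has_field_derivative_iff by (metis tendsto_unique)
qed

section \<open>Multiple roots of the quartic\<close>

lemma multiple_root_values:
  fixes n Q R :: "'a::field_char_0"
  assumes F: "n^4 - 2/3 * Q * n^2 + 8/27 * R * n - 1/27 * Q^2 = 0"
    and F': "4 * n^3 - 4/3 * Q * n + 8/27 * R = 0"
  shows "Q = 9 * n^2" "R = 27 * n^3"
proof -
  \<comment> \<open>Eliminating \<open>R\<close> leaves a perfect square.\<close>
  have "(Q - 9 * n^2)^2 = 27 * (n * (4 * n^3 - 4/3 * Q * n + 8/27 * R)
      - (n^4 - 2/3 * Q * n^2 + 8/27 * R * n - 1/27 * Q^2))"
    by (simp add: field_simps power2_eq_square power3_eq_cube power4_eq_xxxx)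
  then show Q: "Q = 9 * n^2" by (simp only: F F') simp
  have "R - 27 * n^3 = 27/8 * (4 * n^3 - 4/3 * Q * n + 8/27 * R)"
    unfolding Q by (simp add: field_simps power2_eq_square power3_eq_cube)
  then show "R = 27 * n^3" by (simp only: F') simp
qed

text \<open>
  The factorisation \<open>(\<nu> - a/3)\<^sup>3 (\<nu> + a)\<close> of the quartic on the discriminant locus, in the
  denominator-free form obtained from \<open>a = R / Q\<close>.
\<close>

lemma roots_on_discriminant_locus:
  fixes n Q R :: "'a::field_char_0"
  assumes F: "n^4 - 2/3 * Q * n^2 + 8/27 * R * n - 1/27 * Q^2 = 0"
    and disc: "Q^3 - R^2 = 0"
  shows "3 * n * Q = R \<or> n * Q = - R"
proof -
  have R2: "R^2 = Q^3" using disc by simp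
  have R3: "R^3 = Q^3 * R" and R4: "R^4 = Q^6"
    using arg_cong[OF R2, of "\<lambda>t. t * R"] arg_cong[OF R2, of "\<lambda>t. t^2"]
    by (simp_all add: power2_eq_square power3_eq_cube power4_eq_xxxx eval_nat_numeral mult.assoc)
  have "(3 * n * Q - R)^3 * (n * Q + R)
      = 27 * n^4 * Q^4 - 18 * n^2 * Q^2 * R^2 + 8 * n * Q * R^3 - R^4"
    by (simp add: algebra_simps eval_nat_numeral)
  also have "\<dots> = 27 * Q^4 * (n^4 - 2/3 * Q * n^2 + 8/27 * R * n - 1/27 * Q^2)"
    unfolding R2 R3 R4 by (simp add: field_simps eval_nat_numeral)
  finally have "(3 * n * Q - R)^3 * (n * Q + R) = 0" using F by simp
  then show ?thesis by (auto simp: eq_neg_iff_add_eq_0)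
qed

section \<open>Zeros of the discriminant along a solution\<close>

context
  fixes S :: "'a::real_normed_field set" and P Q R :: "'a \<Rightarrow> 'a"
  assumes S: "locally convex S" and ram: "ramanujan_on S P Q R"
begin

lemma ramanujan_derivatives:
  assumes "x \<in> S"
  shows "(P has_field_derivative 1/6 * ((P x)^2 - Q x)) (at x within S)"
    "(Q has_field_derivative 2/3 * (P x * Q x - R x)) (at x within S)"
    "(R has_field_derivative P x * R x - (Q x)^2) (at x within S)"
  using ram assms by (auto simp: ramanujan_on_def)

lemma ramanujan_continuous: "continuous_on S P" "continuous_on S Q" "continuous_on S R"
  by (rule DERIV_continuous_on, erule ramanujan_derivatives)+

lemma discriminant_vanishes_nearby:
  assumes x: "x \<in> S" and zero: "(Q x)^3 - (R x)^2 = 0"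
  shows "\<forall>\<^sub>F y in nhds x. y \<in> S \<longrightarrow> (Q y)^3 - (R y)^2 = 0"
proof -
  let ?D = "\<lambda>y. (Q y)^3 - (R y)^2"
  have deriv: "(?D has_field_derivative 2 * P y * ?D y) (at y within S)" if "y \<in> S" for y
    using ramanujan_derivatives[OF that]
    by (auto intro!: derivative_eq_intros simp: field_simps eval_nat_numeral)
  define C where "C = norm (P x) + 1"
  have bound: "\<forall>\<^sub>F y in nhds x. y \<in> S \<longrightarrow>
      norm (2 * P y * ?D y) \<le> C * (norm (?D y) + norm (?D y))"
    using eventually_close_within[OF ramanujan_continuous(1) x zero_less_one]
  proof eventually_elim
    case (elim y)
    show ?case
    proof
      assume "y \<in> S"
      then have "norm (P y) \<le> C"
        using elim norm_triangle_ineq2[of "P y" "P x"] by (simp add: dist_norm C_def)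
      then have "norm (P y) * norm (?D y) \<le> C * norm (?D y)"
        by (intro mult_right_mono) auto
      moreover have "norm (2 * P y * ?D y) = 2 * (norm (P y) * norm (?D y))"
        by (simp only: norm_mult norm_numeral mult.assoc)
      ultimately show "norm (2 * P y * ?D y) \<le> C * (norm (?D y) + norm (?D y))"
        by (simp only: distrib_left)
    qed
  qed
  \<comment> \<open>The scalar equation is treated as a system by pairing it with itself.\<close>
  have "\<forall>\<^sub>F y in nhds x. y \<in> S \<longrightarrow> ?D y = 0 \<and> ?D y = 0"
    by (rule vanishing_propagates[OF S x, where C = C and f' = "\<lambda>y. 2 * P y * ?D y"
          and g' = "\<lambda>y. 2 * P y * ?D y"])
      (use deriv bound zero in \<open>auto simp: C_def add_nonneg_pos\<close>)
  then show ?thesis by simp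
qed

text \<open>
  The system for \<open>Q\<close> and \<open>R\<close> is nonlinear only through \<open>Q\<^sup>2\<close>, and near a zero of \<open>Q\<close> this term is
  dominated by \<open>Q\<close>. So zero is locally the only solution through zero.
\<close>

lemma Q_R_vanish_nearby:
  assumes x: "x \<in> S" and zero: "Q x = 0" "R x = 0"
  shows "\<forall>\<^sub>F y in nhds x. y \<in> S \<longrightarrow> Q y = 0 \<and> R y = 0"
proof -
  define C where "C = norm (P x) + 1"
  have C: "C \<ge> 1" by (simp add: C_def)
  have bound: "\<forall>\<^sub>F y in nhds x. y \<in> S \<longrightarrow>
      norm (2/3 * (P y * Q y - R y)) \<le> C * (norm (Q y) + norm (R y)) \<and>
      norm (P y * R y - (Q y)^2) \<le> C * (norm (Q y) + norm (R y))"
    using eventually_close_within[OF ramanujan_continuous(1) x zero_less_one]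
      eventually_close_within[OF ramanujan_continuous(2) x zero_less_one]
  proof eventually_elim
    case (elim y)
    show ?case
    proof
      assume y: "y \<in> S"
      have P: "norm (P y) \<le> C"
        using elim y norm_triangle_ineq2[of "P y" "P x"] by (simp add: dist_norm C_def)
      have Q: "norm (Q y) \<le> C" using elim y zero C by simp
      have "norm (P y * Q y - R y) \<le> norm (P y) * norm (Q y) + 1 * norm (R y)"
        using norm_triangle_ineq4[of "P y * Q y" "R y"] by (simp add: norm_mult)
      also have "\<dots> \<le> C * norm (Q y) + C * norm (R y)"
        using P C by (intro add_mono mult_right_mono) auto
      finally have 1: "norm (P y * Q y - R y) \<le> C * (norm (Q y) + norm (R y))"
        by (simp add: distrib_left)
      have "norm (2/3 * (P y * Q y - R y)) = 2/3 * norm (P y * Q y - R y)"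
        by (simp only: norm_mult norm_divide norm_numeral)
      then have 2: "norm (2/3 * (P y * Q y - R y)) \<le> C * (norm (Q y) + norm (R y))"
        using 1 norm_ge_zero[of "P y * Q y - R y"] by linarith
      have "norm (P y * R y - (Q y)^2) \<le> norm (P y) * norm (R y) + norm (Q y) * norm (Q y)"
        using norm_triangle_ineq4[of "P y * R y" "(Q y)^2"]
        by (simp add: norm_mult power2_eq_square)
      also have "\<dots> \<le> C * norm (R y) + C * norm (Q y)"
        using P Q by (intro add_mono mult_right_mono) auto
      finally have "norm (P y * R y - (Q y)^2) \<le> C * (norm (Q y) + norm (R y))"
        by (simp add: distrib_left)
      with 2 show "norm (2/3 * (P y * Q y - R y)) \<le> C * (norm (Q y) + norm (R y)) \<and>
          norm (P y * R y - (Q y)^2) \<le> C * (norm (Q y) + norm (R y))" by blast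
    qed
  qed
  show ?thesis
    by (rule vanishing_propagates[OF S x _ ramanujan_derivatives(2,3) bound zero])
      (use C in auto)
qed

section \<open>The derivative of the root\<close>

text \<open>
  The heart of the matter. The three cases are a simple root, a multiple root with \<open>Q x \<noteq> 0\<close>, and
  the fully degenerate point \<open>Q x = R x = \<nu> x = 0\<close>; in each of them an equation valid near \<open>x\<close> is
  differentiated at \<open>x\<close>.
\<close>

lemma quartic_root_derivative:
  assumes diff: "\<And>y. y \<in> S \<Longrightarrow> \<nu> field_differentiable (at y within S)"
    and quartic: "\<And>y. y \<in> S \<Longrightarrow>
      (\<nu> y)^4 - 2/3 * Q y * (\<nu> y)^2 + 8/27 * R y * \<nu> y - 1/27 * (Q y)^2 = 0"
    and x: "x \<in> S"
  shows "(\<nu> has_field_derivative 1/3 * P x * \<nu> x + 1/2 * (\<nu> x)^2 - 1/6 * Q x) (at x within S)"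
proof (cases "at x within S = bot")
  case True
  \<comment> \<open>At an isolated point every number is a derivative.\<close>
  then show ?thesis by (simp add: has_field_derivative_iff)
next
  case nontrivial: False
  obtain d where d: "(\<nu> has_field_derivative d) (at x within S)"
    using diff[OF x] by (auto simp: field_differentiable_def)
  note ders = d ramanujan_derivatives[OF x]
  note zero_derivative = derivative_zero_of_eventually_zero[OF _ _ x nontrivial]
  let ?n = "\<nu> x" and ?P = "P x" and ?Q = "Q x" and ?R = "R x"
  let ?F' = "4 * ?n^3 - 4/3 * ?Q * ?n + 8/27 * ?R"
  have F: "?n^4 - 2/3 * ?Q * ?n^2 + 8/27 * ?R * ?n - 1/27 * ?Q^2 = 0"
    using quartic[OF x] .
  have cont: "continuous_on S \<nu>"
    using diff by (meson continuous_on_eq_continuous_within field_differentiable_imp_continuous_at)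
  have "d = 1/3 * ?P * ?n + 1/2 * ?n^2 - 1/6 * ?Q"
  proof (cases "?F' = 0")
    case False
    let ?D = "?F' * d + (- 2/3 * ?n^2 - 2/27 * ?Q) * (2/3 * (?P * ?Q - ?R))
      + 8/27 * ?n * (?P * ?R - ?Q^2)"
    have "((\<lambda>y. (\<nu> y)^4 - 2/3 * Q y * (\<nu> y)^2 + 8/27 * R y * \<nu> y - 1/27 * (Q y)^2)
        has_field_derivative ?D) (at x within S)"
      by (rule DERIV_cong, (rule ders derivative_intros)+) (simp add: field_simps eval_nat_numeral)
    then have "?D = 0"
      by (rule zero_derivative) (intro always_eventually allI impI, rule quartic)
    \<comment> \<open>The quartic is homogeneous of degree 4 for the weights 1, 2, 3 of \<open>\<nu>\<close>, \<open>Q\<close>, \<open>R\<close>. So by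
      Euler's identity the terms with \<open>P\<close> contribute 4/3 of \<open>P\<close> times the quartic.\<close>
    moreover have "?F' * (d - (1/3 * ?P * ?n + 1/2 * ?n^2 - 1/6 * ?Q))
        = ?D - (4/3 * ?P + 2 * ?n) * (?n^4 - 2/3 * ?Q * ?n^2 + 8/27 * ?R * ?n - 1/27 * ?Q^2)"
      by (simp add: field_simps eval_nat_numeral)
    ultimately have "?F' * (d - (1/3 * ?P * ?n + 1/2 * ?n^2 - 1/6 * ?Q)) = 0"
      using F by simp
    with False show ?thesis by simp
  next
    case True
    note QR = multiple_root_values[OF F True]
    show ?thesis
    proof (cases "?n = 0")
      case True
      have "\<forall>\<^sub>F y in nhds x. y \<in> S \<longrightarrow> Q y = 0 \<and> R y = 0"
        using QR True by (intro Q_R_vanish_nearby[OF x]) auto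
      then have "\<forall>\<^sub>F y in nhds x. y \<in> S \<longrightarrow> \<nu> y = 0"
        by eventually_elim (use quartic in fastforce)
      with d have "d = 0" by (rule zero_derivative)
      then show ?thesis using True QR by simp
    next
      case False
      have disc: "\<forall>\<^sub>F y in nhds x. y \<in> S \<longrightarrow> (Q y)^3 - (R y)^2 = 0"
        by (rule discriminant_vanishes_nearby[OF x])
          (simp add: QR power_mult_distrib flip: power_mult)
      \<comment> \<open>The other branch \<open>\<nu> Q = - R\<close> is excluded at \<open>x\<close>, hence near \<open>x\<close>.\<close>
      have "?n * ?Q + ?R = 36 * ?n^3"
        by (simp add: QR eval_nat_numeral algebra_simps)
      then have "norm (?n * ?Q + ?R) > 0" using False by simp
      moreover have "continuous_on S (\<lambda>y. \<nu> y * Q y + R y)"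
        using cont ramanujan_continuous by (intro continuous_intros)
      ultimately have "\<forall>\<^sub>F y in nhds x. y \<in> S \<longrightarrow>
          dist (\<nu> y * Q y + R y) (?n * ?Q + ?R) < norm (?n * ?Q + ?R)"
        using x by (intro eventually_close_within)
      with disc have "\<forall>\<^sub>F y in nhds x. y \<in> S \<longrightarrow> 3 * \<nu> y * Q y - R y = 0"
      proof eventually_elim
        case (elim y)
        show ?case
        proof
          assume y: "y \<in> S"
          have "\<nu> y * Q y + R y \<noteq> 0" using elim(2) y by auto
          then have "\<nu> y * Q y \<noteq> - R y" by (simp add: eq_neg_iff_add_eq_0)
          then show "3 * \<nu> y * Q y - R y = 0"
            using roots_on_discriminant_locus[OF quartic[OF y]] elim(1) y by auto
        qed
      qed
      moreover have "((\<lambda>y. 3 * \<nu> y * Q y - R y) has_field_derivative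
          3 * d * ?Q + 3 * ?n * (2/3 * (?P * ?Q - ?R)) - (?P * ?R - ?Q^2)) (at x within S)"
        by (rule DERIV_cong, (rule ders derivative_intros)+) (simp add: algebra_simps)
      ultimately have "3 * d * ?Q + 3 * ?n * (2/3 * (?P * ?Q - ?R)) - (?P * ?R - ?Q^2) = 0"
        by (intro zero_derivative)
      then have "27 * ?n^2 * (d - (1/3 * ?P * ?n - ?n^2)) = 0"
        unfolding QR by (simp add: field_simps eval_nat_numeral)
      then have d_eq: "d = 1/3 * ?P * ?n - ?n^2" using False by simp
      show ?thesis unfolding d_eq QR by simp
    qed
  qed
  with d show ?thesis by simp
qed

end

section \<open>The transformed triple\<close>

theorem theorem2p2:
  fixes S :: "'a::real_normed_field set"
    and P Q R \<nu> :: "'a \<Rightarrow> 'a"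
  assumes "locally convex S"
    and "ramanujan_on S P Q R"
    and "\<And>x. x \<in> S \<Longrightarrow> \<nu> field_differentiable (at x within S)"
    and "\<And>x. x \<in> S \<Longrightarrow>
           (\<nu> x)^4 - 2/3 * Q x * (\<nu> x)^2 + 8/27 * R x * \<nu> x - 1/27 * (Q x)^2 = 0"
  shows "ramanujan_on S
           (\<lambda>x. P x - 2 * \<nu> x)
           (\<lambda>x. - Q x + 10 * (\<nu> x)^2)
           (\<lambda>x. - R x - 35 * (\<nu> x)^3 + 7 * Q x * \<nu> x)"
  unfolding ramanujan_on_def
proof (intro ballI conjI)
  fix x assume x: "x \<in> S"
  have "(\<nu> has_field_derivative 1/3 * P x * \<nu> x + 1/2 * (\<nu> x)^2 - 1/6 * Q x) (at x within S)"
    by (intro quartic_root_derivative[OF assms(1,2)] assms(3,4) x)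
  note ders = this ramanujan_derivatives[OF assms(1,2) x]
  show "((\<lambda>x. P x - 2 * \<nu> x) has_field_derivative
      1/6 * ((P x - 2 * \<nu> x)^2 - (- Q x + 10 * (\<nu> x)^2))) (at x within S)"
    by (rule DERIV_cong, (rule ders derivative_intros)+) (simp add: field_simps eval_nat_numeral)
  show "((\<lambda>x. - Q x + 10 * (\<nu> x)^2) has_field_derivative
      2/3 * ((P x - 2 * \<nu> x) * (- Q x + 10 * (\<nu> x)^2)
        - (- R x - 35 * (\<nu> x)^3 + 7 * Q x * \<nu> x))) (at x within S)"
    by (rule DERIV_cong, (rule ders derivative_intros)+) (simp add: field_simps eval_nat_numeral)
  \<comment> \<open>The two sides of the third equation differ by a multiple of the quartic, whose factor is read
      off from the coefficients of \<open>\<nu>\<^sup>4\<close>: - 105/2 on the left and - 30 on the right.\<close>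
  let ?F = "(\<nu> x)^4 - 2/3 * Q x * (\<nu> x)^2 + 8/27 * R x * \<nu> x - 1/27 * (Q x)^2"
  let ?r' = "(P x - 2 * \<nu> x) * (- R x - 35 * (\<nu> x)^3 + 7 * Q x * \<nu> x)
      - (- Q x + 10 * (\<nu> x)^2)^2"
  have "((\<lambda>x. - R x - 35 * (\<nu> x)^3 + 7 * Q x * \<nu> x) has_field_derivative
      ?r' - 45/2 * ?F) (at x within S)"
    by (rule DERIV_cong, (rule ders derivative_intros)+) (simp add: field_simps eval_nat_numeral)
  then show "((\<lambda>x. - R x - 35 * (\<nu> x)^3 + 7 * Q x * \<nu> x) has_field_derivative ?r')
      (at x within S)"
    by (simp only: assms(4)[OF x]) simp
qed

end
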